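(* Let $T = e_1 T_1 + e_2 T_2 \in L_1^{n}\times_e L_1^{n}$ be a $\mathbb{C}_2$-nilpotent operator and let $T_1$ and $T_2$ be two nilpotent operators of index $k_1$ and $k_2$ respectively. Then $T$ is a $\mathbb{C}_2$-nilpotent operator of the index $\max(k_1,k_2)$, and vice versa.
   Context: $\mathbb{C}_1$ is the field of complex numbers (imaginary unit $i_1$), and $n$ is a positive integer. The bicomplex numbers are $\mathbb{C}_2 = \{z_1 + i_2 z_2 : z_1,z_2\in\mathbb{C}_1\}$, a commutative ring with $i_1^2=i_2^2=-1$ and $i_1 i_2 = i_2 i_1$. Put $e_1 = (1+i_1 i_2)/2$ and $e_2 = (1-i_1 i_2)/2$; these satisfy $e_1^2=e_1$, $e_2^2=e_2$, $e_1e_2=0$, $e_1+e_2=1$. Every $\xi = z_1+i_2 z_2\in\mathbb{C}_2$ is written uniquely as $\xi = \xi^- e_1 + \xi^+ e_2$ with $\xi^- = z_1 - i_1 z_2$ and $\xi^+ = z_1 + i_1 z_2$ in $\mathbb{C}_1$. For $\mathbb{C}_1$-linear operators $T_1,T_2$ on $\mathbb{C}_1^n$, the $\mathbb{C}_1$-linear operator $e_1T_1+e_2T_2:\mathbb{C}_2^n\to\mathbb{C}_2^n$ is defined by $$(e_1T_1+e_2T_2)(\xi_1,\dots,\xi_n) = e_1\cdot T_1(\xi_1^-,\dots,\xi_n^-) + e_2\cdot T_2(\xi_1^+,\dots,\xi_n^+).$$ The set of all such operators is denoted $L_1^n\times_e L_1^n$. An operator $T\in L_1^n\times_e L_1^n$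 is called $\mathbb{C}_2$-nilpotent if $T^k=0$ (the $k$-fold composition) for some positive integer $k$; the smallest such $k$ is called the index of $T$. The index of a nilpotent operator on $\mathbb{C}_1^n$ is likewise the smallest positive integer $k$ for which its $k$-th power vanishes. *)

theory Defs
  imports "HOL-Analysis.Analysis"
begin

text \<open>The value \<open>Bicomplex z1 z2\<close> stands for $z_1 + i_2 z_2$; the imaginary unit $i_1$ of the
  coefficient field is \<^term>\<open>\<i> :: complex\<close>.\<close>

datatype bicomplex = Bicomplex (part1: complex) (part2: complex)

lemma bicomplex_eq_iff: "x = y \<longleftrightarrow> part1 x = part1 y \<and> part2 x = part2 y"
  by (cases x; cases y) auto

instantiation bicomplex :: comm_ring_1
begin

definition "0 = Bicomplex 0 0"
definition "1 = Bicomplex 1 0"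
definition "x + y = Bicomplex (part1 x + part1 y) (part2 x + part2 y)"
definition "x - y = Bicomplex (part1 x - part1 y) (part2 x - part2 y)"
definition "- x = Bicomplex (- part1 x) (- part2 x)"
definition "x * y = Bicomplex (part1 x * part1 y - part2 x * part2 y)
                              (part1 x * part2 y + part2 x * part1 y)"

instance
  by standard
    (auto simp: zero_bicomplex_def one_bicomplex_def plus_bicomplex_def minus_bicomplex_def
      uminus_bicomplex_def times_bicomplex_def algebra_simps intro: bicomplex.expand)

end

lemmas bicomplex_defs =
  zero_bicomplex_def one_bicomplex_def plus_bicomplex_def minus_bicomplex_def
  uminus_bicomplex_def times_bicomplex_def

definition bc_of_complex :: "complex \<Rightarrow> bicomplex" where
  "bc_of_complex z = Bicomplex z 0"

definition i1 :: bicomplex where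
  "i1 = bc_of_complex \<i>"

definition i2 :: bicomplex where
  "i2 = Bicomplex 0 1"

definition e1 :: bicomplex where
  "e1 = bc_of_complex (1/2) * (1 + i1 * i2)"

definition e2 :: bicomplex where
  "e2 = bc_of_complex (1/2) * (1 - i1 * i2)"

text \<open>The idempotent components $\xi^-$ and $\xi^+$.\<close>

definition bc_minus :: "bicomplex \<Rightarrow> complex" where
  "bc_minus \<xi> = part1 \<xi> - \<i> * part2 \<xi>"

definition bc_plus :: "bicomplex \<Rightarrow> complex" where
  "bc_plus \<xi> = part1 \<xi> + \<i> * part2 \<xi>"

lemma bicomplex_units:
  "i1 * i1 = - 1" "i2 * i2 = - 1"
  "Bicomplex z1 z2 = bc_of_complex z1 + i2 * bc_of_complex z2"
  by (simp_all add: bicomplex_defs bc_of_complex_def i1_def i2_def)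

lemma bicomplex_idempotents:
  "e1 * e1 = e1" "e2 * e2 = e2" "e1 * e2 = 0" "e1 + e2 = 1"
  by (simp_all add: bicomplex_defs bc_of_complex_def i1_def i2_def e1_def e2_def field_simps)

lemma bicomplex_idempotent_decomposition:
  "\<xi> = bc_of_complex a * e1 + bc_of_complex b * e2 \<longleftrightarrow> a = bc_minus \<xi> \<and> b = bc_plus \<xi>"
proof
  assume "\<xi> = bc_of_complex a * e1 + bc_of_complex b * e2"
  then show "a = bc_minus \<xi> \<and> b = bc_plus \<xi>"
    by (simp add: bicomplex_defs bc_of_complex_def i1_def i2_def e1_def e2_def
        bc_minus_def bc_plus_def field_simps)
next
  assume "a = bc_minus \<xi> \<and> b = bc_plus \<xi>"
  then show "\<xi> = bc_of_complex a * e1 + bc_of_complex b * e2"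
    by (auto simp: bicomplex_eq_iff bicomplex_defs bc_of_complex_def i1_def i2_def e1_def e2_def
        bc_minus_def bc_plus_def complex_eq_iff diff_divide_distrib add_divide_distrib)
qed

definition L1 :: "(complex ^ 'n \<Rightarrow> complex ^ 'n) set" where
  "L1 = {S. Vector_Spaces.linear (*s) (*s) S}"

text \<open>The operator $e_1 T_1 + e_2 T_2$; a vector over the complex numbers is regarded as a
  bicomplex vector by embedding its coordinates.\<close>

definition e_comb ::
    "(complex ^ 'n \<Rightarrow> complex ^ 'n) \<Rightarrow> (complex ^ 'n \<Rightarrow> complex ^ 'n)
      \<Rightarrow> bicomplex ^ 'n \<Rightarrow> bicomplex ^ 'n" where
  "e_comb T1 T2 \<xi> =
     e1 *s (\<chi> j. bc_of_complex (T1 (\<chi> i. bc_minus (\<xi> $ i)) $ j)) +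
     e2 *s (\<chi> j. bc_of_complex (T2 (\<chi> i. bc_plus (\<xi> $ i)) $ j))"

definition L1_times_e_L1 :: "(bicomplex ^ 'n \<Rightarrow> bicomplex ^ 'n) set" where
  "L1_times_e_L1 = {e_comb T1 T2 | T1 T2. T1 \<in> L1 \<and> T2 \<in> L1}"

definition nilpotent_op :: "('a::zero \<Rightarrow> 'a) \<Rightarrow> bool" where
  "nilpotent_op S \<longleftrightarrow> (\<exists>k>0. S ^^ k = (\<lambda>_. 0))"

text \<open>Only meaningful for nilpotent operators.\<close>

definition nilpotency_index :: "('a::zero \<Rightarrow> 'a) \<Rightarrow> nat" where
  "nilpotency_index S = (LEAST k. k > 0 \<and> S ^^ k = (\<lambda>_. 0))"

definition C2_nilpotent :: "(bicomplex ^ 'n \<Rightarrow> bicomplex ^ 'n) \<Rightarrow> bool" where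
  "C2_nilpotent T \<longleftrightarrow> T \<in> L1_times_e_L1 \<and> nilpotent_op T"

end

theory Submission
  imports Defs
begin

text \<open>The idempotent components give a bijection from bicomplex vectors to pairs of complex
  vectors that conjugates \<^term>\<open>e_comb T1 T2\<close> to the product map of \<^term>\<open>T1\<close> and \<^term>\<open>T2\<close>.
  Hence a power of \<^term>\<open>e_comb T1 T2\<close> vanishes iff the same powers of \<^term>\<open>T1\<close> and \<^term>\<open>T2\<close> do.\<close>

definition vec_minus :: "bicomplex ^ 'n \<Rightarrow> complex ^ 'n" where
  "vec_minus \<xi> = (\<chi> i. bc_minus (\<xi> $ i))"

definition vec_plus :: "bicomplex ^ 'n \<Rightarrow> complex ^ 'n" where
  "vec_plus \<xi> = (\<chi> i. bc_plus (\<xi> $ i))"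

text \<open>Uniqueness of the idempotent decomposition: the coefficients of \<open>e1\<close> and
  \<open>e2\<close> can be read off.\<close>

lemma bc_minus_idempotent_sum: "bc_minus (e1 * bc_of_complex a + e2 * bc_of_complex b) = a"
  and bc_plus_idempotent_sum: "bc_plus (e1 * bc_of_complex a + e2 * bc_of_complex b) = b"
  using bicomplex_idempotent_decomposition[of "e1 * bc_of_complex a + e2 * bc_of_complex b" a b]
  by (simp_all add: mult.commute)

lemma vec_minus_e_comb [simp]: "vec_minus (e_comb T1 T2 \<xi>) = T1 (vec_minus \<xi>)"
  and vec_plus_e_comb [simp]: "vec_plus (e_comb T1 T2 \<xi>) = T2 (vec_plus \<xi>)"
  by (simp_all add: vec_eq_iff vec_minus_def vec_plus_def e_comb_def
      bc_minus_idempotent_sum bc_plus_idempotent_sum)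

lemma vec_minus_zero [simp]: "vec_minus 0 = 0"
  and vec_plus_zero [simp]: "vec_plus 0 = 0"
  by (simp_all add: vec_eq_iff vec_minus_def vec_plus_def bc_minus_def bc_plus_def
      zero_bicomplex_def)

lemma idempotent_components_eqI:
  assumes "vec_minus \<xi> = vec_minus \<eta>" and "vec_plus \<xi> = vec_plus \<eta>"
  shows "\<xi> = \<eta>"
proof -
  have "bc_minus (\<xi> $ j) = bc_minus (\<eta> $ j)" "bc_plus (\<xi> $ j) = bc_plus (\<eta> $ j)" for j
    using assms by (simp_all add: vec_eq_iff vec_minus_def vec_plus_def)
  then have "\<xi> $ j = \<eta> $ j" for j
    by (metis bicomplex_idempotent_decomposition)
  then show ?thesis
    by (simp add: vec_eq_iff)
qed

text \<open>Needed to test a power of \<open>T1\<close> and of \<open>T2\<close> on arbitrary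
  vectors: every pair of arguments comes from one bicomplex vector, built coordinatewise from the
  idempotents.\<close>

lemma idempotent_components_surj:
  obtains \<xi> where "vec_minus \<xi> = x" and "vec_plus \<xi> = y"
proof
  let ?\<xi> = "\<chi> j. e1 * bc_of_complex (x $ j) + e2 * bc_of_complex (y $ j)"
  show "vec_minus ?\<xi> = x" "vec_plus ?\<xi> = y"
    by (simp_all add: vec_eq_iff vec_minus_def vec_plus_def
        bc_minus_idempotent_sum bc_plus_idempotent_sum)
qed

lemma vec_minus_e_comb_funpow: "vec_minus ((e_comb T1 T2 ^^ m) \<xi>) = (T1 ^^ m) (vec_minus \<xi>)"
  and vec_plus_e_comb_funpow: "vec_plus ((e_comb T1 T2 ^^ m) \<xi>) = (T2 ^^ m) (vec_plus \<xi>)"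
  by (induction m) simp_all

lemma e_comb_funpow_eq_zero_iff:
  "e_comb T1 T2 ^^ m = (\<lambda>_. 0) \<longleftrightarrow> T1 ^^ m = (\<lambda>_. 0) \<and> T2 ^^ m = (\<lambda>_. 0)"
proof
  assume zero: "e_comb T1 T2 ^^ m = (\<lambda>_. 0)"
  have "(T1 ^^ m) x = 0 \<and> (T2 ^^ m) y = 0" for x y
  proof -
    obtain \<xi> where "vec_minus \<xi> = x" "vec_plus \<xi> = y"
      by (rule idempotent_components_surj)
    with zero show ?thesis
      using vec_minus_e_comb_funpow[of m T1 T2 \<xi>] vec_plus_e_comb_funpow[of m T1 T2 \<xi>] by simp
  qed
  then show "T1 ^^ m = (\<lambda>_. 0) \<and> T2 ^^ m = (\<lambda>_. 0)"
    by auto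
next
  assume "T1 ^^ m = (\<lambda>_. 0) \<and> T2 ^^ m = (\<lambda>_. 0)"
  then show "e_comb T1 T2 ^^ m = (\<lambda>_. 0)"
    by (auto intro!: ext idempotent_components_eqI
        simp: vec_minus_e_comb_funpow vec_plus_e_comb_funpow)
qed

lemma funpow_eq_zero_mono:
  fixes S :: "'a::zero \<Rightarrow> 'a"
  assumes "S ^^ k = (\<lambda>_. 0)" and "k \<le> m"
  shows "S ^^ m = (\<lambda>_. 0)"
proof -
  \<comment> \<open>With \<open>S ^^ k\<close> outermost the composite is zero whatever the inner
    power returns; the opposite order would call for \<open>S 0 = 0\<close>.\<close>
  have "S ^^ m = S ^^ k \<circ> S ^^ (m - k)"
    using assms(2) by (simp flip: funpow_add)
  with assms(1) show ?thesis
    by auto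
qed

text \<open>The positive exponents at which \<open>S\<close> vanishes are closed upwards, so the
  least one determines them all. This trades \<open>LEAST\<close> for a comparison with an arbitrary
  \<open>m\<close>.\<close>

lemma nilpotency_index_le_iff:
  assumes "nilpotent_op S"
  shows "nilpotency_index S \<le> m \<longleftrightarrow> 0 < m \<and> S ^^ m = (\<lambda>_. 0)"
proof -
  have "0 < nilpotency_index S \<and> S ^^ nilpotency_index S = (\<lambda>_. 0)"
    using assms unfolding nilpotent_op_def nilpotency_index_def by (rule LeastI_ex)
  moreover have "nilpotency_index S \<le> m" if "0 < m \<and> S ^^ m = (\<lambda>_. 0)"
    unfolding nilpotency_index_def using that by (rule Least_le)
  ultimately show ?thesis
    using funpow_eq_zero_mono by (meson le_trans less_le_trans)
qed

lemma nilpotent_op_e_comb_iff: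
  "nilpotent_op (e_comb T1 T2) \<longleftrightarrow> nilpotent_op T1 \<and> nilpotent_op T2"
proof
  assume "nilpotent_op T1 \<and> nilpotent_op T2"
  \<comment> \<open>The maximum bounds both indices, so both powers vanish at this common
    exponent.\<close>
  then have "0 < m \<and> e_comb T1 T2 ^^ m = (\<lambda>_. 0)"
    if "m = max (nilpotency_index T1) (nilpotency_index T2)" for m
    using that nilpotency_index_le_iff[of T1 m] nilpotency_index_le_iff[of T2 m]
    by (simp add: e_comb_funpow_eq_zero_iff)
  then show "nilpotent_op (e_comb T1 T2)"
    unfolding nilpotent_op_def by blast
qed (auto simp: nilpotent_op_def e_comb_funpow_eq_zero_iff)

lemma nilpotency_index_e_comb:
  assumes "nilpotent_op T1" and "nilpotent_op T2"
  shows "nilpotency_index (e_comb T1 T2) = max (nilpotency_index T1) (nilpotency_index T2)"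
proof -
  \<comment> \<open>Both sides say that \<open>m\<close> is positive and that \<open>T1 ^^ m\<close>
    and \<open>T2 ^^ m\<close> vanish. Numbers with the same upper bounds are equal: take
    \<open>m\<close> to be each of them in turn.\<close>
  have "nilpotency_index (e_comb T1 T2) \<le> m
      \<longleftrightarrow> max (nilpotency_index T1) (nilpotency_index T2) \<le> m" for m
    using assms by (auto simp: nilpotency_index_le_iff nilpotent_op_e_comb_iff
        e_comb_funpow_eq_zero_iff)
  then show ?thesis
    by (meson le_antisym order_refl)
qed

theorem theorem3p7:
  fixes T1 T2 :: "complex ^ 'n \<Rightarrow> complex ^ 'n"
    and T :: "bicomplex ^ 'n \<Rightarrow> bicomplex ^ 'n"
  assumes "T1 \<in> L1" and "T2 \<in> L1" and "T = e_comb T1 T2"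
  shows "(\<forall>k1 k2. C2_nilpotent T
            \<and> nilpotent_op T1 \<and> nilpotency_index T1 = k1
            \<and> nilpotent_op T2 \<and> nilpotency_index T2 = k2
            \<longrightarrow> C2_nilpotent T \<and> nilpotency_index T = max k1 k2)
       \<and> (\<forall>k. C2_nilpotent T \<and> nilpotency_index T = k
            \<longrightarrow> (\<exists>k1 k2. nilpotent_op T1 \<and> nilpotency_index T1 = k1
                   \<and> nilpotent_op T2 \<and> nilpotency_index T2 = k2
                   \<and> k = max k1 k2))"
  \<comment> \<open>In both directions nilpotency of \<open>T\<close> passes to \<open>T1\<close>
    and \<open>T2\<close>, so the index formula applies; in the converse the equations themselves
    fix \<open>k1\<close> and \<open>k2\<close>.\<close>
  using assms(3) by (simp add: C2_nilpotent_def nilpotent_op_e_comb_iff nilpotency_index_e_comb)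

end
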